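(* The generating function $T_1(x)=\sum_{n\ge 0} t_n^{\#1}x^n$ of the sequence $\{t_n^{\#1}\}_{n\geq0}$ is $$T_1(x)=\frac{6-2\sqrt{1-8x}-3\sqrt{2+2\sqrt{1-8x}+8x}+ \sqrt{1-8x}\,\sqrt{2+2\sqrt{1-8x}+8x}}{8}.$$
   Context: A bracketed implication with $n$ distinct variables is a formula obtained from $p_1\to p_2\to\cdots\to p_n$ (variables in this fixed order) by fully inserting brackets; for $n\ge2$ it has the form $\psi\to\phi$ with $\psi$ a bracketing of $p_1\to\cdots\to p_i$ and $\phi$ a bracketing of $p_{i+1}\to\cdots\to p_n$ for some $1\le i\le n-1$. A row is a pair consisting of a bracketed formula and a valuation of $p_1,\dots,p_n$ in $\{0,1\}$ (0 = false, 1 = true). For $n\ge 2$, $t_n^{\#1}$ is the number of rows (over all bracketed implications in $n$ variables) for which $\psi$ and $\phi$ both have value 1 (so that $\psi\to\phi$ is true); $t_0^{\#1}=t_1^{\#1}=0$. Square roots denote formal power series with positive constant term. *)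

theory Defs
  imports
    "HOL-Library.FuncSet"
    "HOL-Computational_Algebra.Formal_Power_Series"
begin

datatype formula = Var nat | Imp formula formula

fun leaves :: "formula \<Rightarrow> nat list" where
  "leaves (Var i) = [i]"
| "leaves (Imp \<psi> \<phi>) = leaves \<psi> @ leaves \<phi>"

fun val :: "(nat \<Rightarrow> bool) \<Rightarrow> formula \<Rightarrow> bool" where
  "val v (Var i) = v i"
| "val v (Imp \<psi> \<phi>) = (val v \<psi> \<longrightarrow> val v \<phi>)"

text \<open>A formula is a bracketing of \<open>p\<^sub>1 \<rightarrow> p\<^sub>2 \<rightarrow> \<dots> \<rightarrow> p\<^sub>n\<close> iff erasing its brackets
  leaves the variables \<open>p\<^sub>1, \<dots>, p\<^sub>n\<close> in this order. There is none for \<open>n = 0\<close>.\<close>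

definition bracketed_implications :: "nat \<Rightarrow> formula set" where
  "bracketed_implications n = {f. leaves f = [1..<Suc n]}"

text \<open>Valuations are extensional functions on \<open>{1..n}\<close>, so that each assignment to
  \<open>p\<^sub>1, \<dots>, p\<^sub>n\<close> is counted exactly once.\<close>

definition rows :: "nat \<Rightarrow> (formula \<times> (nat \<Rightarrow> bool)) set" where
  "rows n = bracketed_implications n \<times> ({1..n} \<rightarrow>\<^sub>E (UNIV :: bool set))"

definition t1 :: "nat \<Rightarrow> nat" where
  "t1 n = (if n < 2 then 0
           else card {(f, v) \<in> rows n. \<exists>\<psi> \<phi>. f = Imp \<psi> \<phi> \<and> val v \<psi> \<and> val v \<phi>})"

definition T1 :: "real fps" where
  "T1 = Abs_fps (\<lambda>n. real (t1 n))"

definition fps_sqrt :: "real fps \<Rightarrow> real fps" where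
  "fps_sqrt a = fps_radical root 2 a"

text \<open>For a series with positive constant term, \<open>fps_sqrt\<close> is its unique square root
  with positive constant term.\<close>

lemma fps_sqrt_power2:
  assumes "fps_nth a 0 > 0"
  shows "fps_sqrt a ^ 2 = a"
proof -
  have "root (Suc 1) (fps_nth a 0) ^ Suc 1 = fps_nth a 0"
    using assms by (intro real_root_pow_pos2) auto
  then have "fps_radical root (Suc 1) a ^ Suc 1 = a"
    using assms power_radical[of a root 1] by simp
  then show ?thesis
    by (simp only: fps_sqrt_def numeral_2_eq_2 One_nat_def)
qed

lemma fps_sqrt_nth_0_pos:
  assumes "fps_nth a 0 > 0"
  shows "fps_nth (fps_sqrt a) 0 > 0"
  using assms by (simp add: fps_sqrt_def)

lemma fps_sqrt_unique:
  assumes "fps_nth a 0 > 0" "s ^ 2 = a" "fps_nth s 0 > 0"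
  shows "s = fps_sqrt a"
proof -
  have "s ^ 2 = fps_sqrt a ^ 2"
    using assms fps_sqrt_power2 by simp
  then have "s = fps_sqrt a \<or> s = - fps_sqrt a"
    by (simp add: power2_eq_iff)
  moreover have "s \<noteq> - fps_sqrt a"
  proof
    assume "s = - fps_sqrt a"
    then have "fps_nth s 0 = - fps_nth (fps_sqrt a) 0"
      by simp
    then show False
      using assms(3) fps_sqrt_nth_0_pos[OF assms(1)] by linarith
  qed
  ultimately show ?thesis
    by simp
qed

end

theory Submission
  imports Defs
begin

text \<open>Recording in each leaf the truth value of its variable turns a row into a binary tree with
  Boolean leaves. Let \<open>T\<close>, \<open>F\<close> and \<open>G\<close> be the generating functions, by number of leaves, of the
  true, the false and all such trees. Splitting a tree at its root gives \<open>G = 2x + G\<^sup>2\<close> and, since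
  an implication is false only for a true antecedent and a false consequent, \<open>F = x + T F\<close>. Together
  with \<open>G = T + F\<close> these say that \<open>1 - 2G\<close> and \<open>1 + (1 - 2G) + 4F\<close> are the two square roots
  of the formula, and the required series is \<open>T\<^sup>2\<close>.\<close>

section \<open>Binary trees with Boolean leaves\<close>

datatype btree = Leaf bool | Node btree btree

fun leaf_count :: "btree \<Rightarrow> nat" where
  "leaf_count (Leaf b) = 1"
| "leaf_count (Node l r) = leaf_count l + leaf_count r"

fun truth :: "btree \<Rightarrow> bool" where
  "truth (Leaf b) = b"
| "truth (Node l r) = (truth l \<longrightarrow> truth r)"

fun evaluate :: "(nat \<Rightarrow> bool) \<Rightarrow> formula \<Rightarrow> btree" where
  "evaluate v (Var i) = Leaf (v i)"
| "evaluate v (Imp \<psi> \<phi>) = Node (evaluate v \<psi>) (evaluate v \<phi>)"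

lemma leaf_count_pos: "0 < leaf_count t"
  by (induction t) auto

text \<open>Every tree has a leaf, so both children of a node with \<open>n\<close> leaves have
  fewer than \<open>n\<close> and lie in the finite set \<open>?S\<close>.\<close>

lemma finite_leaf_count: "finite {t. leaf_count t = n}"
proof (induction n rule: less_induct)
  case (less n)
  let ?S = "\<Union>i<n. {t. leaf_count t = i}"
  have "{t. leaf_count t = n} \<subseteq> range Leaf \<union> case_prod Node ` (?S \<times> ?S)"
  proof
    fix t assume "t \<in> {t. leaf_count t = n}"
    then show "t \<in> range Leaf \<union> case_prod Node ` (?S \<times> ?S)"
      by (cases t) (auto simp: leaf_count_pos)
  qed
  moreover have "finite ?S"
    using less by blast
  ultimately show ?case
    by (meson finite_SigmaI finite_UnI finite_class.finite_UNIV finite_imageI finite_subset)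
qed

section \<open>Generating functions of sets of trees\<close>

definition gf :: "btree set \<Rightarrow> real fps" where
  "gf A = Abs_fps (\<lambda>n. real (card {t \<in> A. leaf_count t = n}))"

lemma gf_nth: "fps_nth (gf A) n = real (card {t \<in> A. leaf_count t = n})"
  by (simp add: gf_def)

lemma finite_leaf_count_in: "finite {t \<in> A. leaf_count t = n}"
  by (rule finite_subset[OF _ finite_leaf_count[of n]]) auto

lemma gf_nth_0: "fps_nth (gf A) 0 = 0"
proof -
  have "{t \<in> A. leaf_count t = 0} = {}"
    using leaf_count_pos by (metis (mono_tags, lifting) Collect_empty_eq less_numeral_extra(3))
  then show ?thesis
    by (simp only: gf_nth card.empty of_nat_0)
qed

lemma gf_Un:
  assumes "A \<inter> B = {}"
  shows "gf (A \<union> B) = gf A + gf B"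
proof (rule fps_ext)
  fix n
  have "{t \<in> A \<union> B. leaf_count t = n} = {t \<in> A. leaf_count t = n} \<union> {t \<in> B. leaf_count t = n}"
    by auto
  moreover have "{t \<in> A. leaf_count t = n} \<inter> {t \<in> B. leaf_count t = n} = {}"
    using assms by auto
  ultimately show "fps_nth (gf (A \<union> B)) n = fps_nth (gf A + gf B) n"
    by (simp add: gf_nth card_Un_disjoint finite_leaf_count_in)
qed

lemma gf_Leaf: "gf {Leaf b} = fps_X"
proof (rule fps_ext)
  fix n
  have "{t \<in> {Leaf b}. leaf_count t = n} = (if n = 1 then {Leaf b} else {})"
    by auto
  then show "fps_nth (gf {Leaf b}) n = fps_nth fps_X n"
    by (simp add: gf_nth)
qed

text \<open>Sorting the nodes with \<open>n\<close> leaves by the leaf count \<open>i\<close> of the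
  left child yields the Cauchy product, since \<open>Node\<close> is injective.\<close>

lemma gf_Node: "gf (case_prod Node ` (A \<times> B)) = gf A * gf B"
proof (rule fps_ext)
  fix n
  let ?P = "\<lambda>i. {t \<in> A. leaf_count t = i} \<times> {t \<in> B. leaf_count t = n - i}"
  have "{t \<in> case_prod Node ` (A \<times> B). leaf_count t = n} = case_prod Node ` (\<Union>i\<in>{0..n}. ?P i)"
    by (auto simp: image_iff)
  then have "card {t \<in> case_prod Node ` (A \<times> B). leaf_count t = n} = card (\<Union>i\<in>{0..n}. ?P i)"
    by (simp only:) (rule card_image, auto simp: inj_on_def)
  also have "\<dots> = (\<Sum>i=0..n. card (?P i))"
    by (rule card_UN_disjoint) (auto simp: finite_leaf_count_in)
  finally show "fps_nth (gf (case_prod Node ` (A \<times> B))) n = fps_nth (gf A * gf B) n"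
    by (simp add: gf_nth fps_mult_nth card_cartesian_product)
qed

section \<open>Functional equations from splitting at the root\<close>

lemma gf_UNIV: "gf UNIV = 2 * fps_X + gf UNIV * gf UNIV"
proof -
  have "(UNIV :: btree set) = ({Leaf True} \<union> {Leaf False}) \<union> case_prod Node ` (UNIV \<times> UNIV)"
    (is "_ = ?R")
  proof -
    have "t \<in> ?R" for t
      by (cases t) auto
    then show ?thesis
      by blast
  qed
  then have "gf UNIV = gf ?R"
    by (rule arg_cong)
  also have "\<dots> = gf {Leaf True} + gf {Leaf False} + gf (case_prod Node ` (UNIV \<times> UNIV))"
    by (subst gf_Un, force, subst gf_Un) auto
  finally show ?thesis
    by (simp only: gf_Leaf gf_Node mult_2)
qed

lemma gf_false: "gf {t. \<not> truth t} = fps_X + gf {t. truth t} * gf {t. \<not> truth t}"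
proof -
  have "t \<in> {t. \<not> truth t} \<longleftrightarrow>
      t \<in> {Leaf False} \<union> case_prod Node ` ({t. truth t} \<times> {t. \<not> truth t})" for t
    by (cases t) auto
  then have "{t. \<not> truth t} = {Leaf False} \<union> case_prod Node ` ({t. truth t} \<times> {t. \<not> truth t})"
    by blast
  then have "gf {t. \<not> truth t} = gf ({Leaf False} \<union> case_prod Node ` ({t. truth t} \<times> {t. \<not> truth t}))"
    by (rule arg_cong)
  also have "\<dots> = gf {Leaf False} + gf (case_prod Node ` ({t. truth t} \<times> {t. \<not> truth t}))"
    by (rule gf_Un) auto
  finally show ?thesis
    by (simp only: gf_Leaf gf_Node)
qed

lemma gf_truth: "gf UNIV = gf {t. truth t} + gf {t. \<not> truth t}"
  by (subst gf_Un[symmetric]) (auto intro: arg_cong[where f = gf])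

section \<open>Rows as trees\<close>

lemma truth_evaluate: "truth (evaluate v f) = val v f"
  by (induction f) auto

lemma leaf_count_evaluate: "leaf_count (evaluate v f) = length (leaves f)"
  by (induction f) auto

text \<open>The tree forgets the names of the variables but keeps the bracketing. Left subformulas
  with the same tree have equally many leaves, so the common list of leaves splits at the same place
  in both formulas.\<close>

lemma evaluate_inject:
  assumes "evaluate v f = evaluate w g" "leaves f = leaves g"
  shows "f = g \<and> (\<forall>i\<in>set (leaves f). v i = w i)"
  using assms
proof (induction f arbitrary: g)
  case (Var i)
  then show ?case by (cases g) auto
next
  case (Imp \<psi> \<phi>)
  obtain \<psi>' \<phi>' where g: "g = Imp \<psi>' \<phi>'"
    using Imp.prems(1) by (cases g) auto
  have eq: "evaluate v \<psi> = evaluate w \<psi>'" "evaluate v \<phi> = evaluate w \<phi>'"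
    using Imp.prems g by auto
  then have "length (leaves \<psi>) = length (leaves \<psi>')"
    by (metis leaf_count_evaluate)
  then have "leaves \<psi> = leaves \<psi>'" "leaves \<phi> = leaves \<phi>'"
    using Imp.prems g by auto
  then show ?case
    using Imp.IH eq g by auto
qed

lemma evaluate_cong: "(\<And>i. i \<in> set (leaves f) \<Longrightarrow> v i = w i) \<Longrightarrow> evaluate v f = evaluate w f"
  by (induction f) auto

text \<open>Cutting \<open>xs\<close> after \<open>leaf_count l\<close> entries serves the two
  subtrees separately. Distinctness makes the two sets of variables disjoint, so the valuations can
  be glued to \<open>?u\<close>.\<close>

lemma evaluate_surj:
  assumes "distinct xs" "length xs = leaf_count t"
  shows "\<exists>f v. leaves f = xs \<and> evaluate v f = t"
  using assms
proof (induction t arbitrary: xs)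
  case (Leaf b)
  then obtain x where "xs = [x]"
    by (auto simp: length_Suc_conv)
  then have "leaves (Var x) = xs \<and> evaluate (\<lambda>_. b) (Var x) = Leaf b"
    by simp
  then show ?case by blast
next
  case (Node l r)
  let ?ys = "take (leaf_count l) xs" and ?zs = "drop (leaf_count l) xs"
  obtain f v where f: "leaves f = ?ys" "evaluate v f = l"
    using Node.IH(1)[of ?ys] Node.prems by auto
  obtain g w where g: "leaves g = ?zs" "evaluate w g = r"
    using Node.IH(2)[of ?zs] Node.prems by auto
  let ?u = "\<lambda>i. if i \<in> set ?ys then v i else w i"
  have disj: "set ?ys \<inter> set ?zs = {}"
    using Node.prems by (simp add: set_take_disj_set_drop_if_distinct)
  have "evaluate ?u f = evaluate v f" "evaluate ?u g = evaluate w g"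
    using f(1) g(1) disj by (auto intro!: evaluate_cong)
  then have "leaves (Imp f g) = xs \<and> evaluate ?u (Imp f g) = Node l r"
    using f g by simp
  then show ?case by blast
qed

lemma bij_betw_evaluate:
  "bij_betw (\<lambda>(f, v). evaluate v f) (rows n) {t. leaf_count t = n}"
  unfolding bij_betw_def
proof
  show "inj_on (\<lambda>(f, v). evaluate v f) (rows n)"
  proof (rule inj_onI, clarify)
    fix f v g w
    assume "(f, v) \<in> rows n" "(g, w) \<in> rows n" and eq: "evaluate v f = evaluate w g"
    then have f: "leaves f = [1..<Suc n]" and g: "leaves g = [1..<Suc n]"
      and v: "v \<in> {1..n} \<rightarrow>\<^sub>E UNIV" and w: "w \<in> {1..n} \<rightarrow>\<^sub>E UNIV"
      by (auto simp: rows_def bracketed_implications_def)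
    have *: "f = g \<and> (\<forall>i\<in>set (leaves f). v i = w i)"
      using evaluate_inject[OF eq] f g by simp
    have "set (leaves f) = {1..n}"
      unfolding f by auto
    \<comment> \<open>Both valuations are extensional, so agreement on the variables of
      \<open>f\<close> is enough.\<close>
    then have "v = w"
      using * by (intro PiE_ext[OF v w]) auto
    then show "f = g \<and> v = w"
      using * by simp
  qed
  show "(\<lambda>(f, v). evaluate v f) ` rows n = {t. leaf_count t = n}"
  proof (intro equalityI subsetI)
    fix t assume "t \<in> (\<lambda>(f, v). evaluate v f) ` rows n"
    then show "t \<in> {t. leaf_count t = n}"
      by (auto simp: rows_def bracketed_implications_def leaf_count_evaluate)
  next
    fix t assume "t \<in> {t. leaf_count t = n}"
    then obtain f v where f: "leaves f = [1..<Suc n]" and t: "evaluate v f = t"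
      using evaluate_surj[of "[1..<Suc n]" t] by (auto simp del: upt_Suc)
    let ?v = "restrict v {1..n}"
    have "evaluate ?v f = t"
      unfolding t[symmetric] by (rule evaluate_cong) (auto simp: f simp del: upt_Suc)
    moreover have "(f, ?v) \<in> rows n"
      by (simp add: rows_def bracketed_implications_def f)
    ultimately show "t \<in> (\<lambda>(f, v). evaluate v f) ` rows n"
      by force
  qed
qed

lemma T1_eq: "T1 = gf {t. truth t} * gf {t. truth t}"
proof -
  let ?N = "case_prod Node ` ({t. truth t} \<times> {t. truth t})"
  have "t1 n = card {t \<in> ?N. leaf_count t = n}" for n
  proof (cases "n < 2")
    case True
    \<comment> \<open>A node has at least two leaves, in accordance with the value 0 set for
      \<open>t1\<close> below 2.\<close>
    have "leaf_count t \<noteq> n" if t: "t \<in> ?N" for t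
    proof -
      obtain l r where "t = Node l r"
        using t by auto
      then show ?thesis
        using True leaf_count_pos[of l] leaf_count_pos[of r] by simp
    qed
    then have none: "{t \<in> ?N. leaf_count t = n} = {}"
      by blast
    show ?thesis
      using True unfolding none by (simp add: t1_def)
  next
    case False
    let ?R = "{(f, v) \<in> rows n. \<exists>\<psi> \<phi>. f = Imp \<psi> \<phi> \<and> val v \<psi> \<and> val v \<phi>}"
    have iff: "evaluate v f \<in> ?N \<longleftrightarrow> (\<exists>\<psi> \<phi>. f = Imp \<psi> \<phi> \<and> val v \<psi> \<and> val v \<phi>)" for f v
      by (cases f) (auto simp: truth_evaluate)
    have "bij_betw (\<lambda>(f, v). evaluate v f) ?R {t \<in> ?N. leaf_count t = n}"
    proof (rule bij_betw_subset[OF bij_betw_evaluate[of n]])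
      show "(\<lambda>(f, v). evaluate v f) ` ?R = {t \<in> ?N. leaf_count t = n}"
      proof -
        \<comment> \<open>The counted rows are the preimage of \<open>?N\<close>, so their image is
          the whole image cut down to \<open>?N\<close>.\<close>
        have "?R = {p \<in> rows n. (\<lambda>(f, v). evaluate v f) p \<in> ?N}"
          by (simp only: split_beta iff) auto
        moreover have "h ` {p \<in> A. h p \<in> B} = h ` A \<inter> B"
          for h :: "formula \<times> (nat \<Rightarrow> bool) \<Rightarrow> btree" and A B
          by auto
        ultimately have "(\<lambda>(f, v). evaluate v f) ` ?R = (\<lambda>(f, v). evaluate v f) ` rows n \<inter> ?N"
          by simp
        also have "\<dots> = {t. leaf_count t = n} \<inter> ?N"
          by (simp only: bij_betw_imp_surj_on[OF bij_betw_evaluate])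
        finally show ?thesis
          by auto
      qed
    qed auto
    then show ?thesis
      using False by (simp add: t1_def bij_betw_same_card)
  qed
  then have "T1 = gf ?N"
    by (simp add: T1_def gf_def)
  then show ?thesis
    by (simp only: gf_Node)
qed

section \<open>Solving the functional equations\<close>

theorem proposition4p8:
  "T1 =
    (6 - 2 * fps_sqrt (1 - 8 * fps_X)
       - 3 * fps_sqrt (2 + 2 * fps_sqrt (1 - 8 * fps_X) + 8 * fps_X)
       + fps_sqrt (1 - 8 * fps_X) * fps_sqrt (2 + 2 * fps_sqrt (1 - 8 * fps_X) + 8 * fps_X)) / 8"
proof -
  define T F where "T = gf {t. truth t}" and "F = gf {t. \<not> truth t}"
  define s where "s = 1 - 2 * (T + F)"
  define r where "r = 1 + s + 4 * F"
  have G: "T + F = 2 * fps_X + (T + F) * (T + F)"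
    using gf_UNIV unfolding gf_truth T_def F_def .
  have F: "F = fps_X + T * F"
    using gf_false unfolding T_def F_def .
  have "fps_nth T 0 = 0" "fps_nth F 0 = 0"
    by (simp_all add: T_def F_def gf_nth_0)
  \<comment> \<open>Positive constant terms decide the signs of both square roots.\<close>
  then have s0: "fps_nth s 0 = 1" and r0: "fps_nth r 0 = 2"
    by (simp_all add: s_def r_def numeral_fps_const)
  have s2: "s ^ 2 = 1 - 8 * fps_X"
    using G unfolding s_def by algebra
  have r2: "r ^ 2 = 2 + 2 * s + 8 * fps_X"
    using G F unfolding r_def s_def by algebra
  have s: "s = fps_sqrt (1 - 8 * fps_X)"
    using s0 s2 by (intro fps_sqrt_unique) (auto simp: numeral_fps_const)
  have r: "r = fps_sqrt (2 + 2 * s + 8 * fps_X)"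
    using s0 r0 r2 by (intro fps_sqrt_unique) (auto simp: numeral_fps_const)
  \<comment> \<open>The definitions give T = (3 - s - r)/4. On squaring, the terms 8x from
    \<open>s2\<close> and \<open>r2\<close> cancel.\<close>
  have "8 * (T * T) = 6 - 2 * s - 3 * r + s * r"
    using G F unfolding r_def s_def by algebra
  then have "T * T = (6 - 2 * s - 3 * r + s * r) / 8"
    by (metis nonzero_mult_div_cancel_left zero_neq_numeral)
  then show ?thesis
    unfolding T1_eq T_def[symmetric] s[symmetric] r[symmetric] .
qed

end
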